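(* Let $X$ be a second countable locally compact topological space. Then $\mathcal{ML}(X)$ is a $G_\delta$ subset of $(\mathcal{L}(X),\tau_s)$.
   Context: No separation axioms are assumed on topological spaces. Compact means that every open cover has a finite subcover (Hausdorff is not required). A topological space is locally compact if each of its points has a fundamental system of compact neighbourhoods. For a topological space $X$, $\mathcal{F}(X)$ is the set of all closed subsets of $X$ (including $\emptyset$). A subset $L\subset X$ is a limit set if there is a net in $X$ that converges to every point of $L$; equivalently, every finite family of open subsets of $X$ each of which intersects $L$ has nonempty intersection. $\mathcal{L}(X)$ is the set of all closed limit sets of $X$. $\mathcal{ML}(X)$ is the set of all limit sets of $X$ that are maximal with respect to inclusion among limit sets; these are automatically closed, so $\mathcal{ML}(X)\subset\mathcal{L}(X)$. The Fell topology $\tau_s$ on $\mathcal{F}(X)$ has as a base all the sets $\mathcal{U}(C,\Phi)=\{A\in\mathcal{F}(X)\mid A\cap C=\emptyset,\ A\cap O\neq\emptyset \text{ for all } O\in\Phi\}$, where $C$ is a compact (possibly empty) subset of $X$ and $\Phi$ is a finite (possibly empty) family of open subsets of $X$. $\mathcal{L}(X)$ carries the subspace topology, still denoted $\tau_s$. *)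

theory Defs
  imports "HOL-Analysis.Analysis"
begin

definition directed_set :: "'i set \<Rightarrow> ('i \<Rightarrow> 'i \<Rightarrow> bool) \<Rightarrow> bool" where
  "directed_set I le \<longleftrightarrow>
     I \<noteq> {} \<and> reflp_on I le \<and> transp_on I le \<and> (\<forall>i\<in>I. \<forall>j\<in>I. \<exists>k\<in>I. le i k \<and> le j k)"

definition net_converges ::
    "'a topology \<Rightarrow> 'i set \<Rightarrow> ('i \<Rightarrow> 'i \<Rightarrow> bool) \<Rightarrow> ('i \<Rightarrow> 'a) \<Rightarrow> 'a \<Rightarrow> bool" where
  "net_converges X I le s x \<longleftrightarrow>
     x \<in> topspace X \<and>
     (\<forall>U. openin X U \<and> x \<in> U \<longrightarrow> (\<exists>i\<in>I. \<forall>j\<in>I. le i j \<longrightarrow> s j \<in> U))"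

(* A definition cannot quantify over the type of the index set, so it is fixed to be
   'a set set. The lemma limit_set_net below shows that a net over any other
   index type yields the same limit sets. *)
definition limit_set :: "'a topology \<Rightarrow> 'a set \<Rightarrow> bool" where
  "limit_set X L \<longleftrightarrow>
     L \<subseteq> topspace X \<and>
     (\<exists>(I :: 'a set set set) le s.
        directed_set I le \<and> s \<in> I \<rightarrow> topspace X \<and> (\<forall>x\<in>L. net_converges X I le s x))"

definition closed_limit_sets :: "'a topology \<Rightarrow> 'a set set" where
  "closed_limit_sets X = {L. closedin X L \<and> limit_set X L}"

definition maximal_limit_sets :: "'a topology \<Rightarrow> 'a set set" where
  "maximal_limit_sets X = {L. limit_set X L \<and> (\<forall>M. limit_set X M \<and> L \<subseteq> M \<longrightarrow> M = L)}"

definition fell_basic :: "'a topology \<Rightarrow> 'a set \<Rightarrow> 'a set set \<Rightarrow> 'a set set" where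
  "fell_basic X C \<Phi> = {A. closedin X A \<and> A \<inter> C = {} \<and> (\<forall>U\<in>\<Phi>. A \<inter> U \<noteq> {})}"

definition fell_base :: "'a topology \<Rightarrow> 'a set set set" where
  "fell_base X = {fell_basic X C \<Phi> |C \<Phi>. compactin X C \<and> finite \<Phi> \<and> (\<forall>U\<in>\<Phi>. openin X U)}"

definition fell_topology :: "'a topology \<Rightarrow> 'a set topology" where
  "fell_topology X = topology (arbitrary union_of (\<lambda>B. B \<in> fell_base X))"

lemma openin_fell_topology:
  "openin (fell_topology X) = arbitrary union_of (\<lambda>B. B \<in> fell_base X)"
proof -
  have "S \<inter> T \<in> fell_base X" if ST: "S \<in> fell_base X" "T \<in> fell_base X" for S T
  proof -
    from ST obtain C \<Phi> D \<Psi>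
      where S: "S = fell_basic X C \<Phi>" "compactin X C" "finite \<Phi>" "\<forall>U\<in>\<Phi>. openin X U"
        and T: "T = fell_basic X D \<Psi>" "compactin X D" "finite \<Psi>" "\<forall>U\<in>\<Psi>. openin X U"
      unfolding fell_base_def by blast
    have "S \<inter> T = fell_basic X (C \<union> D) (\<Phi> \<union> \<Psi>)"
      unfolding S(1) T(1) fell_basic_def by auto
    moreover have "compactin X (C \<union> D)" "finite (\<Phi> \<union> \<Psi>)" "\<forall>U\<in>\<Phi> \<union> \<Psi>. openin X U"
      using S T by (auto intro: compactin_Un)
    ultimately show ?thesis
      unfolding fell_base_def by blast
  qed
  then have "istopology (arbitrary union_of (\<lambda>B. B \<in> fell_base X))"
    by (intro istopology_base)
  then show ?thesis
    unfolding fell_topology_def by (simp add: topology_inverse')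
qed

lemma topspace_fell_topology: "topspace (fell_topology X) = {A. closedin X A}"
proof -
  have "fell_basic X {} {} \<in> fell_base X"
    unfolding fell_base_def by force
  then have "openin (fell_topology X) (fell_basic X {} {})"
    by (simp add: openin_fell_topology union_of_inc arbitrary_def)
  moreover have "fell_basic X {} {} = {A. closedin X A}"
    by (simp add: fell_basic_def)
  moreover have "topspace (fell_topology X) \<subseteq> {A. closedin X A}"
    using openin_topspace[of "fell_topology X"]
    by (auto simp: openin_fell_topology union_of_def fell_base_def fell_basic_def)
  ultimately show ?thesis
    by (metis openin_subset subset_antisym)
qed

lemma net_finite_intersections:
  assumes dir: "directed_set I le" and s: "s \<in> I \<rightarrow> topspace X"
    and conv: "\<forall>x\<in>L. net_converges X I le s x"
    and fin: "finite \<Phi>" and op: "\<forall>U\<in>\<Phi>. openin X U \<and> U \<inter> L \<noteq> {}"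
  shows "topspace X \<inter> \<Inter>\<Phi> \<noteq> {}"
proof -
  have "\<exists>i\<in>I. \<forall>j\<in>I. le i j \<longrightarrow> s j \<in> \<Inter>\<Phi>"
    using fin op
  proof (induction \<Phi>)
    case empty
    then show ?case using dir by (auto simp: directed_set_def)
  next
    case (insert U \<Phi>)
    then obtain i where i: "i \<in> I" "\<forall>j\<in>I. le i j \<longrightarrow> s j \<in> \<Inter>\<Phi>"
      by auto
    obtain x where "x \<in> U" "x \<in> L" "openin X U"
      using insert.prems by auto
    then obtain k where k: "k \<in> I" "\<forall>j\<in>I. le k j \<longrightarrow> s j \<in> U"
      using conv unfolding net_converges_def by blast
    obtain m where m: "m \<in> I" "le i m" "le k m"
      using dir i(1) k(1) unfolding directed_set_def by blast
    have "s j \<in> \<Inter>(insert U \<Phi>)" if "j \<in> I" "le m j" for j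
    proof -
      have "transp_on I le" using dir by (simp add: directed_set_def)
      then have "le i j" "le k j"
        using that m i(1) k(1) by (blast dest: transp_onD)+
      then show ?thesis using i k that by auto
    qed
    then show ?case using m by blast
  qed
  then obtain i where i: "i \<in> I" "\<forall>j\<in>I. le i j \<longrightarrow> s j \<in> \<Inter>\<Phi>" ..
  have "reflp_on I le"
    using dir by (simp add: directed_set_def)
  then have "s i \<in> \<Inter>\<Phi>"
    using i by (simp add: reflp_onD)
  moreover have "s i \<in> topspace X"
    using s i(1) by (rule Pi_mem)
  ultimately have "s i \<in> topspace X \<inter> \<Inter>\<Phi>" by simp
  then show ?thesis by (rule ex_in_conv[THEN iffD1, OF exI])
qed

(* The intersection of the empty family is the whole space. *)
lemma limit_set_iff_finite_intersections:
  "limit_set X L \<longleftrightarrow>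
     L \<subseteq> topspace X \<and>
     (\<forall>\<Phi>. finite \<Phi> \<and> (\<forall>U\<in>\<Phi>. openin X U \<and> U \<inter> L \<noteq> {}) \<longrightarrow> topspace X \<inter> \<Inter>\<Phi> \<noteq> {})"
    (is "_ \<longleftrightarrow> ?R")
proof
  assume L: "limit_set X L"
  then obtain I :: "'a set set set" and le s
    where net: "directed_set I le" "s \<in> I \<rightarrow> topspace X" "\<forall>x\<in>L. net_converges X I le s x"
    unfolding limit_set_def by (elim conjE exE)
  have "L \<subseteq> topspace X"
    using L by (simp add: limit_set_def)
  then show ?R
    using net_finite_intersections[OF net] by simp
next
  assume R: ?R
  define I where "I = {\<Phi>. finite \<Phi> \<and> (\<forall>U\<in>\<Phi>. openin X U \<and> U \<inter> L \<noteq> {})}"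
  have "\<forall>\<Phi>\<in>I. \<exists>x. x \<in> topspace X \<inter> \<Inter>\<Phi>"
    using R unfolding I_def by blast
  then obtain s where s: "\<And>\<Phi>. \<Phi> \<in> I \<Longrightarrow> s \<Phi> \<in> topspace X \<inter> \<Inter>\<Phi>"
    by metis
  have un: "\<Phi> \<union> \<Psi> \<in> I" if "\<Phi> \<in> I" "\<Psi> \<in> I" for \<Phi> \<Psi>
    using that unfolding I_def by auto
  have "{} \<in> I" by (simp add: I_def)
  then have "directed_set I (\<subseteq>)"
    unfolding directed_set_def
  proof (intro conjI ballI)
    show "I \<noteq> {}" using \<open>{} \<in> I\<close> by blast
    show "reflp_on I (\<subseteq>)" by (rule reflp_onI) simp
    show "transp_on I (\<subseteq>)" by (rule transp_onI) simp
    show "\<exists>k\<in>I. i \<subseteq> k \<and> j \<subseteq> k" if "i \<in> I" "j \<in> I" for i j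
      using un[OF that] by (intro bexI[of _ "i \<union> j"]) auto
  qed
  moreover have "s \<in> I \<rightarrow> topspace X"
    using s by auto
  moreover have "\<forall>x\<in>L. net_converges X I (\<subseteq>) s x"
  proof
    fix x assume "x \<in> L"
    show "net_converges X I (\<subseteq>) s x"
      unfolding net_converges_def
    proof (intro conjI allI impI)
      show "x \<in> topspace X" using R \<open>x \<in> L\<close> by auto
    next
      fix U assume "openin X U \<and> x \<in> U"
      then have "{U} \<in> I" using \<open>x \<in> L\<close> by (auto simp: I_def)
      moreover have "s j \<in> U" if "j \<in> I" "{U} \<subseteq> j" for j
        using s[OF that(1)] that(2) by auto
      ultimately show "\<exists>i\<in>I. \<forall>j\<in>I. i \<subseteq> j \<longrightarrow> s j \<in> U"
        by (intro bexI[of _ "{U}"]) auto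
    qed
  qed
  ultimately show "limit_set X L"
    unfolding limit_set_def using R by (intro conjI exI[of _ I] exI[of _ "(\<subseteq>)"] exI[of _ s]) simp_all
qed

lemma limit_set_net:
  fixes I :: "'i set"
  assumes "directed_set I le" and "s \<in> I \<rightarrow> topspace X"
    and "\<forall>x\<in>L. net_converges X I le s x" and "L \<subseteq> topspace X"
  shows "limit_set X L"
  unfolding limit_set_iff_finite_intersections
  using net_finite_intersections[OF assms(1-3)] assms(4) by simp

end

theory Submission
  imports Defs
begin

text \<open>
  A limit set \<open>L\<close> is maximal iff every point \<open>x \<notin> L\<close> has an open neighbourhood \<open>V\<close> that is disjoint
  from \<open>\<Inter>\<Phi>\<close> for some finite family \<open>\<Phi>\<close> of open sets meeting \<open>L\<close>. By compactness, one \<open>\<Phi>\<close> then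
  works for a whole neighbourhood of any compact set \<open>K\<close> disjoint from \<open>L\<close>. Hence, if
  \<open>U \<subseteq> K \<subseteq> W\<close> with \<open>K\<close> compact and \<open>U\<close>, \<open>W\<close> in a countable base, \<open>L\<close> meets \<open>W\<close> or some such \<open>\<Phi>\<close>
  satisfies \<open>U \<inter> \<Inter>\<Phi> = \<emptyset>\<close>. Each of these conditions is open in the Fell topology (no miss condition
  is involved), there are countably many of them, and by local compactness they force maximality.
\<close>

text \<open>An open set meets the closure of \<open>L\<close> only if it meets \<open>L\<close>, so
  the finite intersection criterion carries over.\<close>

lemma limit_set_closure:
  assumes "limit_set X L"
  shows "limit_set X (X closure_of L)"
  unfolding limit_set_iff_finite_intersections
proof (intro conjI allI impI)
  show "X closure_of L \<subseteq> topspace X"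
    by (rule closure_of_subset_topspace)
next
  fix \<Phi>
  assume "finite \<Phi> \<and> (\<forall>U\<in>\<Phi>. openin X U \<and> U \<inter> X closure_of L \<noteq> {})"
  then have "finite \<Phi> \<and> (\<forall>U\<in>\<Phi>. openin X U \<and> U \<inter> L \<noteq> {})"
    by (metis openin_Int_closure_of_eq_empty)
  then show "topspace X \<inter> \<Inter>\<Phi> \<noteq> {}"
    using assms by (simp add: limit_set_iff_finite_intersections)
qed

lemma maximal_limit_sets_subset: "maximal_limit_sets X \<subseteq> closed_limit_sets X"
proof
  fix L assume L: "L \<in> maximal_limit_sets X"
  then have lim: "limit_set X L"
    by (simp add: maximal_limit_sets_def)
  then have "L \<subseteq> X closure_of L"
    by (simp add: closure_of_subset limit_set_def)
  then have "X closure_of L = L"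
    using L limit_set_closure[OF lim] by (simp add: maximal_limit_sets_def)
  then have "closedin X L"
    by (metis closedin_closure_of)
  then show "L \<in> closed_limit_sets X"
    using lim by (simp add: closed_limit_sets_def)
qed

text \<open>By maximality, adjoining \<open>x\<close> to \<open>L\<close> violates the finite
  intersection criterion; the violating family yields both \<open>V\<close> and
  \<open>\<Phi>\<close>.\<close>

lemma maximal_limit_set_separates_point:
  assumes L: "L \<in> maximal_limit_sets X" and x: "x \<in> topspace X" "x \<notin> L"
  obtains V \<Phi> where "openin X V" "x \<in> V" "finite \<Phi>"
    "\<forall>U\<in>\<Phi>. openin X U \<and> L \<inter> U \<noteq> {}" "V \<inter> \<Inter>\<Phi> = {}"
proof -
  have "\<not> limit_set X (insert x L)"
    using L x(2) by (auto simp: maximal_limit_sets_def)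
  moreover have "L \<subseteq> topspace X"
    using L by (simp add: maximal_limit_sets_def limit_set_def)
  ultimately obtain \<Psi> where \<Psi>: "finite \<Psi>" "\<forall>U\<in>\<Psi>. openin X U \<and> U \<inter> insert x L \<noteq> {}"
      "topspace X \<inter> \<Inter>\<Psi> = {}"
    using x(1) unfolding limit_set_iff_finite_intersections by auto
  \<comment> \<open>Split \<open>\<Psi>\<close> by membership of \<open>x\<close>. Members avoiding
    \<open>x\<close> still meet \<open>insert x L\<close>, hence meet \<open>L\<close>. The factor
    \<open>topspace X\<close> covers the case where no member contains \<open>x\<close>.\<close>
  define V where "V = topspace X \<inter> \<Inter>{U\<in>\<Psi>. x \<in> U}"
  define \<Phi> where "\<Phi> = {U\<in>\<Psi>. x \<notin> U}"
  show thesis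
  proof
    show "openin X V"
      unfolding V_def using \<Psi> by (intro openin_Int_Inter) auto
    show "x \<in> V" "finite \<Phi>" "V \<inter> \<Inter>\<Phi> = {}"
      using x \<Psi> by (auto simp: V_def \<Phi>_def)
    show "\<forall>U\<in>\<Phi>. openin X U \<and> L \<inter> U \<noteq> {}"
      using \<Psi>(2) by (auto simp: \<Phi>_def)
  qed
qed

text \<open>Finitely many separated neighbourhoods cover \<open>K\<close>. The union of their
  families works for all of them at once, since enlarging a family shrinks its intersection.\<close>

lemma maximal_limit_set_separates_compact:
  assumes L: "L \<in> maximal_limit_sets X" and K: "compactin X K" "L \<inter> K = {}"
  obtains \<Phi> where "finite \<Phi>" "\<forall>U\<in>\<Phi>. openin X U \<and> L \<inter> U \<noteq> {}" "K \<inter> \<Inter>\<Phi> = {}"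
proof -
  define sep where "sep V \<Phi> \<longleftrightarrow> finite \<Phi> \<and> (\<forall>U\<in>\<Phi>. openin X U \<and> L \<inter> U \<noteq> {}) \<and> V \<inter> \<Inter>\<Phi> = {}"
    for V \<Phi>
  have "K \<subseteq> \<Union>{V. openin X V \<and> (\<exists>\<Phi>. sep V \<Phi>)}"
  proof
    fix x assume "x \<in> K"
    then have "x \<in> topspace X" "x \<notin> L"
      using K compactin_subset_topspace by blast+
    then obtain V \<Phi> where "openin X V" "x \<in> V" "sep V \<Phi>"
      using maximal_limit_set_separates_point[OF L] unfolding sep_def by metis
    then show "x \<in> \<Union>{V. openin X V \<and> (\<exists>\<Phi>. sep V \<Phi>)}"
      by blast
  qed
  then obtain F where F: "finite F" "F \<subseteq> {V. openin X V \<and> (\<exists>\<Phi>. sep V \<Phi>)}" "K \<subseteq> \<Union>F"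
    using compactinD[OF K(1), of "{V. openin X V \<and> (\<exists>\<Phi>. sep V \<Phi>)}"] by auto
  then have "\<forall>V\<in>F. \<exists>\<Phi>. sep V \<Phi>"
    by blast
  then obtain \<Phi> where \<Phi>: "\<forall>V\<in>F. sep V (\<Phi> V)"
    by (rule bchoice[THEN exE])
  show thesis
  proof
    show "finite (\<Union>(\<Phi> ` F))" "\<forall>U\<in>\<Union>(\<Phi> ` F). openin X U \<and> L \<inter> U \<noteq> {}"
      using F(1) \<Phi> by (auto simp: sep_def)
    have "y \<notin> \<Inter>(\<Union>(\<Phi> ` F))" if y: "y \<in> K" for y
    proof -
      obtain V where V: "V \<in> F" "y \<in> V"
        using F(3) y by blast
      then have "V \<inter> \<Inter>(\<Phi> V) = {}"
        using \<Phi> by (simp add: sep_def)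
      then show ?thesis
        using V by blast
    qed
    then show "K \<inter> \<Inter>(\<Union>(\<Phi> ` F)) = {}"
      by blast
  qed
qed

lemma openin_fell_basic_hit:
  assumes "finite \<Phi>" "\<forall>U\<in>\<Phi>. openin X U"
  shows "openin (fell_topology X) (fell_basic X {} \<Phi>)"
proof -
  have "fell_basic X {} \<Phi> \<in> fell_base X"
    unfolding fell_base_def using assms compactin_empty by blast
  then show ?thesis
    by (simp add: openin_fell_topology union_of_inc arbitrary_def)
qed

text \<open>For open \<open>U\<close>, the second alternative prevents any limit set containing
  \<open>A\<close> from meeting \<open>U\<close>.\<close>

definition hit_or_separated :: "'a topology \<Rightarrow> 'a set \<Rightarrow> 'a set \<Rightarrow> 'a set set" where
  "hit_or_separated X U W = {A. closedin X A \<and> (A \<inter> W \<noteq> {} \<or>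
     (\<exists>\<Phi>. finite \<Phi> \<and> (\<forall>V\<in>\<Phi>. openin X V \<and> A \<inter> V \<noteq> {}) \<and> U \<inter> \<Inter>\<Phi> = {}))}"

text \<open>The possibly uncountable choice of \<open>\<Phi>\<close> is harmless: it only produces a
  union of basic open sets.\<close>

lemma openin_hit_or_separated:
  assumes "openin X W"
  shows "openin (fell_topology X) (hit_or_separated X U W)"
proof -
  have "hit_or_separated X U W = fell_basic X {} {W} \<union>
      \<Union>(fell_basic X {} ` {\<Phi>. finite \<Phi> \<and> (\<forall>V\<in>\<Phi>. openin X V) \<and> U \<inter> \<Inter>\<Phi> = {}})"
    unfolding hit_or_separated_def fell_basic_def by auto
  then show ?thesis
    using assms by (auto intro!: openin_Un openin_Union openin_fell_basic_hit)
qed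

lemma maximal_limit_set_hit_or_separated:
  assumes L: "L \<in> maximal_limit_sets X" and K: "compactin X K" "U \<subseteq> K" "K \<subseteq> W"
  shows "L \<in> hit_or_separated X U W"
proof -
  have "closedin X L"
    using subsetD[OF maximal_limit_sets_subset L] by (simp add: closed_limit_sets_def)
  moreover have "\<exists>\<Phi>. finite \<Phi> \<and> (\<forall>V\<in>\<Phi>. openin X V \<and> L \<inter> V \<noteq> {}) \<and> U \<inter> \<Inter>\<Phi> = {}"
    if "L \<inter> W = {}"
  proof -
    have "L \<inter> K = {}"
      using that K(3) by blast
    then obtain \<Phi> where "finite \<Phi>" "\<forall>V\<in>\<Phi>. openin X V \<and> L \<inter> V \<noteq> {}" "K \<inter> \<Inter>\<Phi> = {}"
      using maximal_limit_set_separates_compact[OF L K(1)] by blast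
    moreover have "U \<inter> \<Inter>\<Phi> = {}"
      using calculation(3) K(2) by blast
    ultimately show ?thesis by blast
  qed
  ultimately show ?thesis
    by (cases "L \<inter> W = {}") (simp_all add: hit_or_separated_def)
qed

lemma hit_or_separated_imp_maximal:
  assumes L: "L \<in> closed_limit_sets X"
    and sep: "\<And>x. x \<in> topspace X - L \<Longrightarrow>
      \<exists>U W. openin X U \<and> x \<in> U \<and> L \<inter> W = {} \<and> L \<in> hit_or_separated X U W"
  shows "L \<in> maximal_limit_sets X"
proof -
  have "M = L" if M: "limit_set X M" "L \<subseteq> M" for M
  proof (rule ccontr)
    assume "M \<noteq> L"
    then obtain x where x: "x \<in> M" "x \<notin> L"
      using M(2) by blast
    then have "x \<in> topspace X - L"
      using M(1) by (auto simp: limit_set_def)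
    from sep[OF this] obtain U W
      where U: "openin X U" "x \<in> U" and "L \<inter> W = {}" "L \<in> hit_or_separated X U W"
      by (elim exE conjE)
    then obtain \<Phi> where \<Phi>: "finite \<Phi>" "\<forall>V\<in>\<Phi>. openin X V \<and> L \<inter> V \<noteq> {}" "U \<inter> \<Inter>\<Phi> = {}"
      by (auto simp: hit_or_separated_def)
    \<comment> \<open>\<open>U\<close> meets \<open>M\<close> at \<open>x\<close>, and the members
      of \<open>\<Phi>\<close> meet \<open>M\<close> because they meet \<open>L\<close>; yet the
      enlarged family has empty intersection.\<close>
    have "finite (insert U \<Phi>) \<and> (\<forall>V\<in>insert U \<Phi>. openin X V \<and> V \<inter> M \<noteq> {})"
      using U \<Phi>(1,2) x M(2) by blast
    then have "topspace X \<inter> \<Inter>(insert U \<Phi>) \<noteq> {}"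
      using M(1) unfolding limit_set_iff_finite_intersections by blast
    then show False
      using \<Phi>(3) by auto
  qed
  then show ?thesis
    using L by (auto simp: maximal_limit_sets_def closed_limit_sets_def)
qed

theorem theorem4p8:
  fixes X :: "'a topology"
  assumes "second_countable X"
    and "neighbourhood_base_of (compactin X) X"
  shows "gdelta_in (subtopology (fell_topology X) (closed_limit_sets X)) (maximal_limit_sets X)"
proof -
  let ?Y = "subtopology (fell_topology X) (closed_limit_sets X)"
  obtain B where B: "countable B" "\<And>V. V \<in> B \<Longrightarrow> openin X V"
      "\<And>U x. openin X U \<Longrightarrow> x \<in> U \<Longrightarrow> \<exists>V\<in>B. x \<in> V \<and> V \<subseteq> U"
    using assms(1) unfolding second_countable_def by metis
  define P where "P = {(U, W) \<in> B \<times> B. \<exists>K. compactin X K \<and> U \<subseteq> K \<and> K \<subseteq> W}"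
  \<comment> \<open>The inserted set keeps \<open>G\<close> nonempty even if \<open>P\<close> is
    empty, and confines \<open>\<Inter>G\<close> to closed limit sets.\<close>
  define G where "G = insert (closed_limit_sets X)
    ((\<lambda>(U, W). closed_limit_sets X \<inter> hit_or_separated X U W) ` P)"
  have top: "topspace ?Y = closed_limit_sets X"
    by (auto simp: topspace_fell_topology closed_limit_sets_def)
  have "countable P"
    using countable_SIGMA[OF B(1), of "\<lambda>_. B"] B(1) by (auto simp: P_def intro: countable_subset)
  then have "countable G"
    by (simp add: G_def)
  moreover have "gdelta_in ?Y S" if "S \<in> G" for S
  proof (rule open_imp_gdelta_in)
    show "openin ?Y S"
      using that top openin_topspace[of ?Y] B(2)
      by (auto simp: G_def P_def intro!: openin_subtopology_Int2 openin_hit_or_separated)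
  qed
  ultimately have "gdelta_in ?Y (\<Inter>G)"
    by (intro gdelta_in_Inter) (auto simp: G_def)
  moreover have "\<Inter>G = maximal_limit_sets X"
  proof
    show "maximal_limit_sets X \<subseteq> \<Inter>G"
    proof
      fix L assume L: "L \<in> maximal_limit_sets X"
      then have "L \<in> closed_limit_sets X"
        using maximal_limit_sets_subset by (rule rev_subsetD)
      moreover have "L \<in> hit_or_separated X U W" if "(U, W) \<in> P" for U W
        using that maximal_limit_set_hit_or_separated[OF L] unfolding P_def by blast
      ultimately show "L \<in> \<Inter>G"
        by (auto simp: G_def)
    qed
    show "\<Inter>G \<subseteq> maximal_limit_sets X"
    proof
      fix L assume "L \<in> \<Inter>G"
      then have L: "L \<in> closed_limit_sets X"
        and H: "\<And>U W. (U, W) \<in> P \<Longrightarrow> L \<in> hit_or_separated X U W"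
        by (auto simp: G_def)
      show "L \<in> maximal_limit_sets X"
      proof (rule hit_or_separated_imp_maximal[OF L])
        fix x assume x: "x \<in> topspace X - L"
        have "openin X (topspace X - L)"
          using L by (auto simp: closed_limit_sets_def)
        \<comment> \<open>Taking \<open>W\<close> inside the complement of \<open>L\<close> rules
          out the hit alternative, so membership in \<open>hit_or_separated X U W\<close> must come
          from separation.\<close>
        then obtain W where W: "W \<in> B" "x \<in> W" "W \<subseteq> topspace X - L"
          using B(3) x by meson
        then obtain V K where V: "openin X V" "compactin X K" "x \<in> V" "V \<subseteq> K" "K \<subseteq> W"
          using assms(2) B(2) unfolding neighbourhood_base_of by meson
        \<comment> \<open>Local compactness gives an arbitrary open \<open>V\<close>; shrinking it
          to a base member puts the pair into the countable set \<open>P\<close>.\<close>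
        then obtain U where U: "U \<in> B" "x \<in> U" "U \<subseteq> V"
          using B(3) by meson
        then have "(U, W) \<in> P"
          using V W by (auto simp: P_def)
        then have "L \<in> hit_or_separated X U W"
          by (rule H)
        moreover have "openin X U" "L \<inter> W = {}"
          using B(2)[OF U(1)] W(3) by auto
        ultimately show "\<exists>U W. openin X U \<and> x \<in> U \<and> L \<inter> W = {} \<and> L \<in> hit_or_separated X U W"
          using U(2) by blast
      qed
    qed
  qed
  ultimately show ?thesis by simp
qed

end
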